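(* Let $K$ be a field with algebraic closure $\overline K$ and let $\{P_1,\ldots,P_5\}$ be five distinct points of $\mathbb{P}^2(\overline K)$. Assume that no four distinct points among $\{P_1,\ldots,P_5\}$ are contained in a line. Then the space of sextics with double points at $P_1,\ldots,P_5$, up to scalar multiplication, is of dimension $12$.
   Context: A sextic is given by a homogeneous polynomial $F\in\overline K[x,y,z]$ of degree $6$. "With double points at $P_1,\dots,P_5$" means that $F$ satisfies the linear conditions expressing that it is singular at each $P_i$, i.e. in an affine chart around $P_i$ the constant and degree-one terms of the Taylor expansion of $F$ at $P_i$ vanish (three linear conditions for each point). "Up to scalar multiplication" means the dimension is that of the projective space of such forms, i.e. one less than the dimension of the $\overline K$-vector space of such $F$. *)

theory Defs
  imports
    "HOL-Analysis.Cartesian_Space"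
    "HOL-Library.Poly_Mapping"
    "HOL-Algebra.Algebraic_Closure_Type"
begin

no_notation fps_nth (infixl \<open>$\<close> 75)

section \<open>The projective plane\<close>

definition proj_rel :: "'a::field ^ 3 \<Rightarrow> 'a ^ 3 \<Rightarrow> bool" where
  "proj_rel v w \<longleftrightarrow> v \<noteq> 0 \<and> w \<noteq> 0 \<and> (\<exists>c. c \<noteq> 0 \<and> w = c *s v)"

lemma part_equivp_proj_rel: "part_equivp (proj_rel :: 'a::field ^ 3 \<Rightarrow> _)"
proof (rule part_equivpI)
  have "proj_rel (1 :: 'a ^ 3) 1"
    unfolding proj_rel_def by (auto intro!: exI[of _ 1])
  thus "\<exists>v. proj_rel (v :: 'a ^ 3) v" ..
  show "symp (proj_rel :: 'a ^ 3 \<Rightarrow> _)"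
  proof (rule sympI)
    fix v w :: "'a ^ 3"
    assume "proj_rel v w"
    then obtain c where c: "v \<noteq> 0" "w \<noteq> 0" "c \<noteq> 0" "w = c *s v"
      by (auto simp: proj_rel_def)
    hence "v = inverse c *s w"
      by (simp add: vector_smult_assoc)
    with c show "proj_rel w v"
      unfolding proj_rel_def by (metis inverse_nonzero_iff_nonzero)
  qed
  show "transp (proj_rel :: 'a ^ 3 \<Rightarrow> _)"
    unfolding proj_rel_def
    by (rule transpI) (metis vector_smult_assoc mult_eq_0_iff)
qed

quotient_type (overloaded) 'a proj_plane = "'a::field ^ 3" / partial: proj_rel
  by (rule part_equivp_proj_rel)

lift_definition on_line :: "'a::field ^ 3 \<Rightarrow> 'a proj_plane \<Rightarrow> bool"
  is "\<lambda>l v. (\<Sum>i\<in>UNIV. l $ i * v $ i) = 0"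
proof -
  fix l v w :: "'a ^ 3"
  assume "proj_rel v w"
  then obtain c where "c \<noteq> 0" "w = c *s v"
    by (auto simp: proj_rel_def)
  moreover from this have "(\<Sum>i\<in>UNIV. l $ i * w $ i) = c * (\<Sum>i\<in>UNIV. l $ i * v $ i)"
    by (simp add: sum_distrib_left mult_ac)
  ultimately show "((\<Sum>i\<in>UNIV. l $ i * v $ i) = 0) = ((\<Sum>i\<in>UNIV. l $ i * w $ i) = 0)"
    by simp
qed

definition contained_in_line :: "'a::field proj_plane set \<Rightarrow> bool" where
  "contained_in_line S \<longleftrightarrow> (\<exists>l. l \<noteq> 0 \<and> (\<forall>p\<in>S. on_line l p))"


section \<open>Polynomials in three variables\<close>

text \<open>
  A monomial is its exponent vector, and a polynomial is a finitely supported family of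
  coefficients. Multiplication of such families is convolution, i.e. polynomial multiplication.
\<close>

type_synonym monom3 = "3 \<Rightarrow>\<^sub>0 nat"
type_synonym 'a poly3 = "monom3 \<Rightarrow>\<^sub>0 'a"

definition mdeg :: "monom3 \<Rightarrow> nat" where
  "mdeg m = (\<Sum>i\<in>UNIV. Poly_Mapping.lookup m i)"

definition Const3 :: "'a::comm_ring_1 \<Rightarrow> 'a poly3" where
  "Const3 c = Poly_Mapping.single 0 c"

definition Var3 :: "3 \<Rightarrow> 'a::comm_ring_1 poly3" where
  "Var3 i = Poly_Mapping.single (Poly_Mapping.single i 1) 1"

definition scale3 :: "'a::comm_ring_1 \<Rightarrow> 'a poly3 \<Rightarrow> 'a poly3" where
  "scale3 c F = Poly_Mapping.map ((*) c) F"

lemma lookup_scale3 [simp]: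
  "Poly_Mapping.lookup (scale3 c F) m = c * Poly_Mapping.lookup F m"
  by (simp add: scale3_def Poly_Mapping.map.rep_eq when_def)

interpretation poly3: vector_space "scale3 :: 'a::field \<Rightarrow> _"
  by unfold_locales
    (auto intro!: poly_mapping_eqI simp: Poly_Mapping.lookup_add algebra_simps)

definition subst3 :: "(3 \<Rightarrow> 'a::comm_ring_1 poly3) \<Rightarrow> 'a poly3 \<Rightarrow> 'a poly3" where
  "subst3 s F = (\<Sum>m\<in>Poly_Mapping.keys F.
     Const3 (Poly_Mapping.lookup F m) * (\<Prod>j\<in>UNIV. s j ^ Poly_Mapping.lookup m j))"

text \<open>The zero polynomial is homogeneous of every degree.\<close>

definition homogeneous3 :: "nat \<Rightarrow> 'a::zero poly3 \<Rightarrow> bool" where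
  "homogeneous3 d F \<longleftrightarrow> (\<forall>m\<in>Poly_Mapping.keys F. mdeg m = d)"


section \<open>Double points\<close>

text \<open>
  If the \<open>i\<close>-th coordinate of \<open>v\<close> is nonzero, the point with homogeneous coordinates \<open>v\<close>
  has affine coordinates \<open>v $ j / v $ i\<close> for \<open>j \<noteq> i\<close> in the chart where the \<open>i\<close>-th
  coordinate is \<open>1\<close>. The following is the Taylor expansion at that point of the
  dehomogenisation of \<open>F\<close>, written in the local coordinates \<open>Var3 j\<close> with \<open>j \<noteq> i\<close>. It is
  obtained by substitution rather than from derivatives, so it is correct in every
  characteristic.
\<close>

definition taylor_chart :: "3 \<Rightarrow> 'a::field ^ 3 \<Rightarrow> 'a poly3 \<Rightarrow> 'a poly3" where
  "taylor_chart i v F =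
     subst3 (\<lambda>j. if j = i then 1 else Const3 (v $ j / v $ i) + Var3 j) F"

definition double_in_chart :: "3 \<Rightarrow> 'a::field ^ 3 \<Rightarrow> 'a poly3 \<Rightarrow> bool" where
  "double_in_chart i v F \<longleftrightarrow>
     (\<forall>m. mdeg m \<le> 1 \<longrightarrow> Poly_Mapping.lookup (taylor_chart i v F) m = 0)"

lemma taylor_chart_scale:
  "c \<noteq> 0 \<Longrightarrow> taylor_chart i (c *s v) F = taylor_chart i v F"
  by (simp add: taylor_chart_def cong: if_cong)

lemma mdeg_le_1_iff: "mdeg m \<le> 1 \<longleftrightarrow> m = 0 \<or> (\<exists>k. m = Poly_Mapping.single k 1)"
proof
  assume le: "mdeg m \<le> 1"
  show "m = 0 \<or> (\<exists>k. m = Poly_Mapping.single k 1)"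
  proof (cases "m = 0")
    case False
    then obtain k where k: "Poly_Mapping.lookup m k \<noteq> 0"
      by (metis lookup_zero poly_mapping_eqI)
    have eq: "mdeg m = Poly_Mapping.lookup m k + (\<Sum>j\<in>UNIV-{k}. Poly_Mapping.lookup m j)"
      unfolding mdeg_def by (rule sum.remove) auto
    have k1: "Poly_Mapping.lookup m k = 1"
      using le eq k by linarith
    have "(\<Sum>j\<in>UNIV-{k}. Poly_Mapping.lookup m j) = 0"
      using le eq k by linarith
    hence j0: "\<forall>j\<in>UNIV-{k}. Poly_Mapping.lookup m j = 0"
      by (subst (asm) sum_eq_0_iff) auto
    have "m = Poly_Mapping.single k 1"
      using k1 j0 by (intro poly_mapping_eqI) (auto simp: lookup_single when_def)
    thus ?thesis by blast
  qed auto
next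
  assume "m = 0 \<or> (\<exists>k. m = Poly_Mapping.single k 1)"
  thus "mdeg m \<le> 1"
    by (auto simp: mdeg_def lookup_single when_def)
qed

lemma monom3_add_eq_single:
  "Poly_Mapping.single k 1 = l + (r :: monom3) \<longleftrightarrow>
     l = 0 \<and> r = Poly_Mapping.single k 1 \<or> l = Poly_Mapping.single k 1 \<and> r = 0"
proof
  assume eq: "Poly_Mapping.single k 1 = l + r"
  have "mdeg l + mdeg r = mdeg (l + r)"
    by (simp add: mdeg_def lookup_add sum.distrib)
  also have "\<dots> = 1"
    by (simp flip: eq add: mdeg_def lookup_single when_def)
  finally have "mdeg l = 0 \<or> mdeg r = 0" by linarith
  moreover have "m = 0" if "mdeg m = 0" for m
    using that by (intro poly_mapping_eqI) (simp add: mdeg_def)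
  ultimately have "l = 0 \<or> r = 0" by blast
  thus "l = 0 \<and> r = Poly_Mapping.single k 1 \<or> l = Poly_Mapping.single k 1 \<and> r = 0"
    using eq by auto
qed auto

lemma single_1_ne_0: "Poly_Mapping.single k (1::nat) \<noteq> 0"
  by (metis lookup_single_eq lookup_zero zero_neq_one)

lemma lookup_mult_0:
  fixes p q :: "'a::comm_ring_1 poly3"
  shows "Poly_Mapping.lookup (p * q) 0 = Poly_Mapping.lookup p 0 * Poly_Mapping.lookup q 0"
proof -
  have *: "0 = l + r \<longleftrightarrow> l = 0 \<and> r = 0" for l r :: monom3
    by (auto simp: poly_mapping_eq_iff fun_eq_iff lookup_add)
  have "(\<Sum>r. Poly_Mapping.lookup q r when (0 = l + r)) = (Poly_Mapping.lookup q 0 when l = 0)" for l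
    by (cases "l = 0") (simp_all add: *)
  thus ?thesis
    unfolding lookup_mult by (simp add: mult_when)
qed

lemma lookup_mult_1:
  fixes p q :: "'a::comm_ring_1 poly3"
  defines "e \<equiv> \<lambda>k. Poly_Mapping.single k 1"
  shows "Poly_Mapping.lookup (p * q) (e k) =
           Poly_Mapping.lookup p 0 * Poly_Mapping.lookup q (e k) +
           Poly_Mapping.lookup p (e k) * Poly_Mapping.lookup q 0"
proof -
  have ne: "e k \<noteq> 0"
    unfolding e_def by (rule single_1_ne_0)
  have *: "(\<Sum>r. Poly_Mapping.lookup q r when (e k = l + r)) =
      (if l = 0 then Poly_Mapping.lookup q (e k)
       else if l = e k then Poly_Mapping.lookup q 0 else 0)" for l
    using ne unfolding e_def monom3_add_eq_single by auto
  have "Poly_Mapping.lookup (p * q) (e k) = (\<Sum>l\<in>{0, e k}. Poly_Mapping.lookup p l *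
      (if l = 0 then Poly_Mapping.lookup q (e k)
       else if l = e k then Poly_Mapping.lookup q 0 else 0))"
    unfolding lookup_mult * by (rule Sum_any.expand_superset) auto
  thus ?thesis using ne by simp
qed

lemma lookup_power_0:
  fixes p :: "'a::comm_ring_1 poly3"
  shows "Poly_Mapping.lookup (p ^ n) 0 = Poly_Mapping.lookup p 0 ^ n"
  by (induction n) (simp_all add: lookup_mult_0 lookup_one)

lemma lookup_power_1:
  fixes p :: "'a::comm_ring_1 poly3"
  defines "e \<equiv> \<lambda>k. Poly_Mapping.single k 1"
  shows "Poly_Mapping.lookup (p ^ n) (e k) =
           of_nat n * Poly_Mapping.lookup p 0 ^ (n - 1) * Poly_Mapping.lookup p (e k)"
proof (induction n)
  case 0
  show ?case
    using single_1_ne_0[of k] by (simp add: e_def lookup_one del: One_nat_def)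
next
  case (Suc n)
  thus ?case
    by (cases n) (simp_all add: e_def lookup_mult_1 lookup_power_0 lookup_mult_0
                    lookup_one when_def algebra_simps del: One_nat_def)
qed

lemma lookup_prod_0:
  fixes f :: "'b \<Rightarrow> 'a::comm_ring_1 poly3"
  shows "Poly_Mapping.lookup (prod f A) 0 = (\<Prod>j\<in>A. Poly_Mapping.lookup (f j) 0)"
  by (induction A rule: infinite_finite_induct) (simp_all add: lookup_mult_0)

lemma lookup_prod_1:
  fixes f :: "'b \<Rightarrow> 'a::comm_ring_1 poly3"
  defines "e \<equiv> \<lambda>k. Poly_Mapping.single k 1"
  assumes "finite A"
  shows "Poly_Mapping.lookup (prod f A) (e k) =
           (\<Sum>j\<in>A. Poly_Mapping.lookup (f j) (e k) * (\<Prod>l\<in>A-{j}. Poly_Mapping.lookup (f l) 0))"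
  using assms(2)
proof (induction A rule: finite_induct)
  case empty
  show ?case
    using single_1_ne_0[of k] by (simp add: e_def lookup_one del: One_nat_def)
next
  case (insert a A)
  have "(\<Prod>l\<in>insert a A - {j}. Poly_Mapping.lookup (f l) 0) =
        Poly_Mapping.lookup (f a) 0 * (\<Prod>l\<in>A-{j}. Poly_Mapping.lookup (f l) 0)"
    if "j \<in> A" for j
  proof -
    have "insert a A - {j} = insert a (A - {j})" "a \<notin> A - {j}"
      using that insert by auto
    thus ?thesis using insert by simp
  qed
  moreover have "insert a A - {a} = A" using insert by auto
  ultimately show ?case
    using insert
    by (simp add: e_def lookup_mult_1 lookup_prod_0 sum_distrib_left mult_ac del: One_nat_def
              cong: sum.cong)
qed

definition eval3 :: "'a::comm_ring_1 poly3 \<Rightarrow> 'a ^ 3 \<Rightarrow> 'a" where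
  "eval3 F v = (\<Sum>m\<in>Poly_Mapping.keys F.
     Poly_Mapping.lookup F m * (\<Prod>j\<in>UNIV. v $ j ^ Poly_Mapping.lookup m j))"

text \<open>The value at \<open>v\<close> of the formal partial derivative of \<open>F\<close> with respect to variable \<open>k\<close>.\<close>

definition pderiv3 :: "3 \<Rightarrow> 'a::comm_ring_1 poly3 \<Rightarrow> 'a ^ 3 \<Rightarrow> 'a" where
  "pderiv3 k F v = (\<Sum>m\<in>Poly_Mapping.keys F.
     Poly_Mapping.lookup F m * of_nat (Poly_Mapping.lookup m k) *
       v $ k ^ (Poly_Mapping.lookup m k - 1) *
       (\<Prod>j\<in>UNIV-{k}. v $ j ^ Poly_Mapping.lookup m j))"

lemma lookup_Const3_mult [simp]:
  "Poly_Mapping.lookup (Const3 c * p) m = c * Poly_Mapping.lookup p m"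
  unfolding Const3_def mult_map_scale_conv_mult [symmetric] scale3_def [symmetric] by simp

lemma lookup_taylor_chart_0:
  assumes "v $ i \<noteq> 0"
  shows "Poly_Mapping.lookup (taylor_chart i v F) 0 = eval3 F (inverse (v $ i) *s v)"
proof -
  have *: "Poly_Mapping.lookup (if j = i then 1 else Const3 (v $ j / v $ i) + Var3 j) 0 =
             (inverse (v $ i) *s v) $ j" for j
    using assms by (simp add: lookup_one lookup_add Const3_def Var3_def lookup_single
                      field_simps when_def poly_mapping_eq_iff fun_eq_iff)
  show ?thesis
    unfolding taylor_chart_def subst3_def lookup_sum lookup_Const3_mult lookup_prod_0
      lookup_power_0 * eval3_def ..
qed

lemma lookup_taylor_chart_1:
  assumes "v $ i \<noteq> 0"
  shows "Poly_Mapping.lookup (taylor_chart i v F) (Poly_Mapping.single k 1) =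
           (if k = i then 0 else pderiv3 k F (inverse (v $ i) *s v))"
proof -
  let ?a = "inverse (v $ i) *s v"
  let ?s = "\<lambda>j. if j = i then 1 else Const3 (v $ j / v $ i) + Var3 j"
  have s0: "Poly_Mapping.lookup (?s j) 0 = ?a $ j" for j
    using assms by (simp add: lookup_one lookup_add Const3_def Var3_def lookup_single
                      field_simps when_def poly_mapping_eq_iff fun_eq_iff)
  have single_ne: "Poly_Mapping.single k (1::nat) \<noteq> 0"
    by (rule single_1_ne_0)
  have single_eq: "Poly_Mapping.single j (1::nat) = Poly_Mapping.single k 1 \<longleftrightarrow> j = k" for j
    by (auto simp: poly_mapping_eq_iff fun_eq_iff lookup_single when_def split: if_splits)
  have s1: "Poly_Mapping.lookup (?s j) (Poly_Mapping.single k 1) =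
              (if j = k \<and> k \<noteq> i then 1 else 0)" for j
    using single_ne single_eq[of j]
    by (auto simp: lookup_one lookup_add Const3_def Var3_def lookup_single when_def
             simp del: One_nat_def)
  have "Poly_Mapping.lookup (\<Prod>j\<in>UNIV. ?s j ^ Poly_Mapping.lookup m j) (Poly_Mapping.single k 1) =
     (if k = i then 0 else of_nat (Poly_Mapping.lookup m k) *
       ?a $ k ^ (Poly_Mapping.lookup m k - 1) *
       (\<Prod>j\<in>UNIV-{k}. ?a $ j ^ Poly_Mapping.lookup m j))" for m
  proof -
    have "Poly_Mapping.lookup (\<Prod>j\<in>UNIV. ?s j ^ Poly_Mapping.lookup m j) (Poly_Mapping.single k 1) =
      (\<Sum>j\<in>UNIV. of_nat (Poly_Mapping.lookup m j) * ?a $ j ^ (Poly_Mapping.lookup m j - 1) *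
         (if j = k \<and> k \<noteq> i then 1 else 0) *
         (\<Prod>l\<in>UNIV-{j}. ?a $ l ^ Poly_Mapping.lookup m l))"
      unfolding lookup_prod_1[OF finite] lookup_power_0 lookup_power_1 s0 s1 ..
    also have "\<dots> = (\<Sum>j\<in>UNIV. if k = j then (if k = i then 0 else of_nat (Poly_Mapping.lookup m j) * 
         ?a $ j ^ (Poly_Mapping.lookup m j - 1) *
         (\<Prod>l\<in>UNIV-{j}. ?a $ l ^ Poly_Mapping.lookup m l)) else 0)"
      by (intro sum.cong) auto
    also have "\<dots> = (if k = i then 0 else of_nat (Poly_Mapping.lookup m k) *
       ?a $ k ^ (Poly_Mapping.lookup m k - 1) *
       (\<Prod>j\<in>UNIV-{k}. ?a $ j ^ Poly_Mapping.lookup m j))"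
      by (subst sum.delta') auto
    finally show ?thesis .
  qed
  thus ?thesis
    by (simp add: taylor_chart_def subst3_def lookup_sum pderiv3_def mult.assoc
             del: One_nat_def vector_smult_component)
qed

lemma eval3_scale:
  assumes "homogeneous3 d F"
  shows "eval3 F (c *s v) = c ^ d * eval3 F v"
  unfolding eval3_def sum_distrib_left
proof (rule sum.cong)
  fix m assume "m \<in> Poly_Mapping.keys F"
  hence "d = (\<Sum>i\<in>UNIV. Poly_Mapping.lookup m i)"
    using assms by (auto simp: homogeneous3_def mdeg_def)
  thus "Poly_Mapping.lookup F m * (\<Prod>j\<in>UNIV. (c *s v) $ j ^ Poly_Mapping.lookup m j) =
        c ^ d * (Poly_Mapping.lookup F m * (\<Prod>j\<in>UNIV. v $ j ^ Poly_Mapping.lookup m j))"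
    by (simp add: power_mult_distrib prod.distrib power_sum)
qed auto

lemma pderiv3_scale:
  assumes "homogeneous3 d F"
  shows "c * pderiv3 k F (c *s v) = c ^ d * pderiv3 k F v"
  unfolding pderiv3_def sum_distrib_left
proof (rule sum.cong)
  fix m assume "m \<in> Poly_Mapping.keys F"
  hence d: "d = Poly_Mapping.lookup m k + (\<Sum>i\<in>UNIV-{k}. Poly_Mapping.lookup m i)"
    using assms sum.remove[of UNIV k "Poly_Mapping.lookup m"]
    by (simp add: homogeneous3_def mdeg_def)
  show "c * (Poly_Mapping.lookup F m * of_nat (Poly_Mapping.lookup m k) *
          (c *s v) $ k ^ (Poly_Mapping.lookup m k - 1) *
          (\<Prod>j\<in>UNIV-{k}. (c *s v) $ j ^ Poly_Mapping.lookup m j)) =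
        c ^ d * (Poly_Mapping.lookup F m * of_nat (Poly_Mapping.lookup m k) *
          v $ k ^ (Poly_Mapping.lookup m k - 1) *
          (\<Prod>j\<in>UNIV-{k}. v $ j ^ Poly_Mapping.lookup m j))"
    by (cases "Poly_Mapping.lookup m k")
       (simp_all add: d power_mult_distrib prod.distrib power_sum power_add)
qed auto

lemma euler3:
  assumes "homogeneous3 d F"
  shows "(\<Sum>k\<in>UNIV. v $ k * pderiv3 k F v) = of_nat d * eval3 F v"
proof -
  have "(\<Sum>k\<in>UNIV. v $ k * pderiv3 k F v) = (\<Sum>k\<in>UNIV. \<Sum>m\<in>Poly_Mapping.keys F.
      of_nat (Poly_Mapping.lookup m k) *
        (Poly_Mapping.lookup F m * (\<Prod>j\<in>UNIV. v $ j ^ Poly_Mapping.lookup m j)))"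
    unfolding pderiv3_def sum_distrib_left
  proof (intro sum.cong refl)
    fix k m
    have "(\<Prod>j\<in>UNIV. v $ j ^ Poly_Mapping.lookup m j) =
        v $ k ^ Poly_Mapping.lookup m k * (\<Prod>j\<in>UNIV-{k}. v $ j ^ Poly_Mapping.lookup m j)"
      by (rule prod.remove) auto
    thus "v $ k * (Poly_Mapping.lookup F m * of_nat (Poly_Mapping.lookup m k) *
            v $ k ^ (Poly_Mapping.lookup m k - 1) *
            (\<Prod>j\<in>UNIV-{k}. v $ j ^ Poly_Mapping.lookup m j)) =
          of_nat (Poly_Mapping.lookup m k) *
            (Poly_Mapping.lookup F m * (\<Prod>j\<in>UNIV. v $ j ^ Poly_Mapping.lookup m j))"
      by (cases "Poly_Mapping.lookup m k") (simp_all add: algebra_simps)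
  qed
  also have "\<dots> = (\<Sum>m\<in>Poly_Mapping.keys F. of_nat (mdeg m) *
        (Poly_Mapping.lookup F m * (\<Prod>j\<in>UNIV. v $ j ^ Poly_Mapping.lookup m j)))"
    by (subst sum.swap) (simp add: mdeg_def sum_distrib_right)
  also have "\<dots> = of_nat d * eval3 F v"
    using assms by (simp add: eval3_def sum_distrib_left homogeneous3_def)
  finally show ?thesis .
qed

text \<open>
  For a form, being singular at a point can be tested in any one chart containing the point;
  in that chart it amounts to three linear conditions.
\<close>

lemma double_in_chart_iff:
  assumes "homogeneous3 d F" "v $ i \<noteq> 0"
  shows "double_in_chart i v F \<longleftrightarrow> eval3 F v = 0 \<and> (\<forall>k. k \<noteq> i \<longrightarrow> pderiv3 k F v = 0)"
proof -
  let ?c = "inverse (v $ i)"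
  have "?c \<noteq> 0" using assms by simp
  hence "pderiv3 k F (?c *s v) = 0 \<longleftrightarrow> pderiv3 k F v = 0" for k
    using pderiv3_scale[OF assms(1), of ?c k v]
    by (metis mult_eq_0_iff power_not_zero)
  moreover have "eval3 F (?c *s v) = 0 \<longleftrightarrow> eval3 F v = 0"
    using \<open>?c \<noteq> 0\<close> by (simp add: eval3_scale[OF assms(1)])
  moreover have "double_in_chart i v F \<longleftrightarrow>
      Poly_Mapping.lookup (taylor_chart i v F) 0 = 0 \<and>
      (\<forall>k. Poly_Mapping.lookup (taylor_chart i v F) (Poly_Mapping.single k 1) = 0)"
    unfolding double_in_chart_def mdeg_le_1_iff by blast
  ultimately show ?thesis
    using assms(2) unfolding lookup_taylor_chart_0[OF assms(2)] lookup_taylor_chart_1[OF assms(2)]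
    by auto
qed

lemma double_in_chart_iff_all_pderivs:
  assumes "homogeneous3 d F" "v $ i \<noteq> 0"
  shows "double_in_chart i v F \<longleftrightarrow> eval3 F v = 0 \<and> (\<forall>k. pderiv3 k F v = 0)"
proof -
  have "pderiv3 i F v = 0" if "eval3 F v = 0" "\<forall>k. k \<noteq> i \<longrightarrow> pderiv3 k F v = 0"
  proof -
    have "(\<Sum>k\<in>UNIV. v $ k * pderiv3 k F v) =
        v $ i * pderiv3 i F v + (\<Sum>k\<in>UNIV-{i}. v $ k * pderiv3 k F v)"
      by (rule sum.remove) auto
    also have "(\<Sum>k\<in>UNIV-{i}. v $ k * pderiv3 k F v) = 0"
      using that by (intro sum.neutral) auto
    finally show ?thesis
      using euler3[OF assms(1), of v] that assms(2) by simp
  qed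
  thus ?thesis
    unfolding double_in_chart_iff[OF assms] by metis
qed

lemma double_in_chart_indep:
  assumes "homogeneous3 d F" "v $ i \<noteq> 0" "v $ j \<noteq> 0"
  shows "double_in_chart i v F \<longleftrightarrow> double_in_chart j v F"
  using assms by (simp add: double_in_chart_iff_all_pderivs)

lift_definition double_at :: "'a::field poly3 \<Rightarrow> 'a proj_plane \<Rightarrow> bool"
  is "\<lambda>F v. \<forall>i. v $ i \<noteq> 0 \<longrightarrow> double_in_chart i v F"
  by (auto simp: proj_rel_def double_in_chart_def taylor_chart_scale)

definition double_forms :: "nat \<Rightarrow> 'a::field proj_plane set \<Rightarrow> 'a poly3 set" where
  "double_forms d S = {F. homogeneous3 d F \<and> (\<forall>p\<in>S. double_at F p)}"

lemma subst3_superset: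
  assumes "finite A" "Poly_Mapping.keys F \<subseteq> A"
  shows "subst3 s F = (\<Sum>m\<in>A.
     Const3 (Poly_Mapping.lookup F m) * (\<Prod>j\<in>UNIV. s j ^ Poly_Mapping.lookup m j))"
  unfolding subst3_def using assms
  by (intro sum.mono_neutral_left) (auto simp: in_keys_iff Const3_def)

lemma lookup_subst3_add:
  "Poly_Mapping.lookup (subst3 s (F + G)) m =
     Poly_Mapping.lookup (subst3 s F) m + Poly_Mapping.lookup (subst3 s G) m"
proof -
  let ?A = "Poly_Mapping.keys F \<union> Poly_Mapping.keys G"
  have "finite ?A" "Poly_Mapping.keys F \<subseteq> ?A" "Poly_Mapping.keys G \<subseteq> ?A"
       "Poly_Mapping.keys (F + G) \<subseteq> ?A"
    using keys_add[of F G] by auto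
  thus ?thesis
    by (simp add: subst3_superset[of ?A] lookup_sum lookup_add distrib_right sum.distrib)
qed

lemma lookup_subst3_scale:
  "Poly_Mapping.lookup (subst3 s (scale3 c F)) m = c * Poly_Mapping.lookup (subst3 s F) m"
proof -
  have "Poly_Mapping.keys (scale3 c F) \<subseteq> Poly_Mapping.keys F"
    by (auto simp: in_keys_iff)
  thus ?thesis
    by (simp add: subst3_superset[of "Poly_Mapping.keys F"] lookup_sum sum_distrib_left mult.assoc)
qed

lemma subspace_double_forms: "poly3.subspace (double_forms d S)"
proof (rule poly3.subspaceI)
  show "0 \<in> double_forms d S"
    unfolding double_forms_def
    by (simp add: homogeneous3_def, transfer)
       (simp add: double_in_chart_def taylor_chart_def subst3_def)
next
  fix F G assume *: "F \<in> double_forms d S" "G \<in> double_forms d S"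
  have "homogeneous3 d (F + G)"
    using * keys_add[of F G] by (auto simp: double_forms_def homogeneous3_def)
  moreover have "double_at (F + G) p" if "double_at F p" "double_at G p" for p
    using that
    by transfer (auto simp: double_in_chart_def taylor_chart_def lookup_subst3_add)
  ultimately show "F + G \<in> double_forms d S"
    using * by (auto simp: double_forms_def)
next
  fix c and F :: "'a poly3"
  assume *: "F \<in> double_forms d S"
  have "homogeneous3 d (scale3 c F)"
    using * by (auto simp: double_forms_def homogeneous3_def in_keys_iff)
  moreover have "double_at (scale3 c F) p" if "double_at F p" for p
    using that
    by transfer (auto simp: double_in_chart_def taylor_chart_def lookup_subst3_scale)
  ultimately show "scale3 c F \<in> double_forms d S"
    using * by (auto simp: double_forms_def)
qed

text \<open>
  The dimension of the projectivisation of a space of forms; it is an integer so that the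
  zero space gets dimension \<open>-1\<close>.
\<close>

definition proj_dim :: "'a::field poly3 set \<Rightarrow> int" where
  "proj_dim V = int (poly3.dim V) - 1"

end

theory Submission
  imports Defs
begin

text \<open>
  Ternary sextics form a space of dimension 28 (\<open>forms_basis\<close>, \<open>card_monom3\<close>), and a double
  point imposes three linear conditions: the value and the two chart derivatives at the point,
  together its one-jet, must vanish. The theorem says that the 15 conditions at the five points
  are independent, so that a space of dimension 28 - 15 = 13 is left. By \<open>dim_common_kernel\<close> it
  is enough to have, for each condition, a sextic that violates it and satisfies the 14 others.
  This follows if, at each of the points \<open>p\<close>, every one-jet is the jet of a sextic that is
  singular at the other four points (\<open>sextic_with_jet\<close>).

  Such a sextic is written down as a product of linear forms. If the line through two of the
  other four points passes through \<open>p\<close>, call that pair bad. Two bad pairs with a point in common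
  would put \<open>p\<close> and three further points on a line, which is excluded; so the bad pairs are
  disjoint, and some splitting of the four points into two pairs has both pairs good
  (\<open>splitting_lines\<close>). Let \<open>L\<close> and \<open>M\<close> be linear forms cutting out the lines through these two
  pairs, and \<open>N\<close> a coordinate that does not vanish at \<open>p\<close>. The quintic \<open>H = L\<^sup>2 M\<^sup>2 N\<close> is singular
  at the four points and nonzero at \<open>p\<close>, and its products with linear forms are again
  singular at the four points. Linear forms realise all one-jets at \<open>p\<close>, and multiplication
  by \<open>H\<close> is invertible on one-jets there (\<open>jet_mult_linear_form_surj\<close>).

  The argument never divides by an integer, so it works in every characteristic.
\<close>

section \<open>Dual families of functionals\<close>

text \<open>
  If \<open>f u\<close> is nonzero, then \<open>x - (f x / f u) u\<close> lies in the kernel of \<open>f\<close>, so \<open>u\<close> completes a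
  basis of the kernel to a basis of \<open>V\<close>. The ambient space of all polynomials has infinite
  dimension; the set \<open>D\<close> only records that \<open>V\<close> is finite-dimensional.
\<close>

lemma (in vector_space) dim_kernel_functional:
  assumes V: "subspace V" and D: "finite D" "V \<subseteq> span D"
    and add: "\<And>x y. f (x + y) = f x + f y" and smul: "\<And>c x. f (scale c x) = c * f x"
    and u: "u \<in> V" "f u \<noteq> 0"
  shows "subspace {x \<in> V. f x = 0}" "dim V = Suc (dim {x \<in> V. f x = 0})"
proof -
  let ?W = "{x \<in> V. f x = 0}"
  have f0: "f 0 = 0"
    using smul[of 0 0] by simp
  show W: "subspace ?W"
    using V by (intro subspaceI) (auto simp: add smul f0 subspace_0 subspace_add subspace_scale)
  obtain B where B: "B \<subseteq> ?W" "independent B" "?W \<subseteq> span B" "card B = dim ?W"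
    by (rule basis_exists)
  have spB: "span B = ?W"
    using B W by (metis span_eq_iff span_mono subset_antisym)
  have fin: "finite B"
    using independent_span_bound[OF D(1) B(2)] B(1) D(2) by blast
  have u': "u \<notin> span B"
    using u spB by simp
  have ind: "independent (insert u B)"
    using u' B(2) by (rule independent_insertI)
  have "V \<subseteq> span (insert u B)"
  proof
    fix x assume x: "x \<in> V"
    have "f (x - scale (f x / f u) u) = f x + f (scale (- (f x / f u)) u)"
      unfolding add[symmetric] by simp
    hence "f (x - scale (f x / f u) u) = 0"
      unfolding smul using u by simp
    moreover have "x - scale (f x / f u) u \<in> V"
      using V x u by (intro subspace_diff subspace_scale)
    ultimately show "x \<in> span (insert u B)"
      unfolding span_breakdown_eq spB by blast
  qed
  moreover have "insert u B \<subseteq> V" using u B by auto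
  ultimately have "dim V = card (insert u B)"
    using ind by (metis basis_card_eq_dim)
  thus "dim V = Suc (dim ?W)"
    using u' fin B(4) by (metis card_insert_disjoint span_base)
qed

text \<open>
  Imposing the conditions one at a time lowers the dimension by one at each step: the vector
  dual to the next functional survives all the earlier conditions. That the common kernel is a
  subspace is carried along because the next step of the induction applies to it.
\<close>

lemma (in vector_space) dim_common_kernel:
  assumes V: "subspace V" and D: "finite D" "V \<subseteq> span D"
    and add: "\<And>j x y. f j (x + y) = f j x + f j y" and smul: "\<And>j c x. f j (scale c x) = c * f j x"
    and J: "finite J"
    and dual: "\<And>j. j \<in> J \<Longrightarrow> \<exists>u\<in>V. f j u \<noteq> 0 \<and> (\<forall>i\<in>J. i \<noteq> j \<longrightarrow> f i u = 0)"
  shows "subspace {x \<in> V. \<forall>j\<in>J. f j x = 0} \<and>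
    dim V = dim {x \<in> V. \<forall>j\<in>J. f j x = 0} + card J"
  using J dual
proof (induction J rule: finite_induct)
  case empty
  thus ?case using V by simp
next
  case (insert a J)
  let ?W = "{x \<in> V. \<forall>j\<in>J. f j x = 0}"
  have IH: "subspace ?W \<and> dim V = dim ?W + card J"
    by (rule insert.IH) (use insert.prems in blast)
  obtain u where u: "u \<in> V" "f a u \<noteq> 0" "\<forall>i\<in>J. i \<noteq> a \<longrightarrow> f i u = 0"
    using insert.prems[of a] by auto
  have uW: "u \<in> ?W" using u insert.hyps by auto
  have "?W \<subseteq> span D" using D by auto
  note step = dim_kernel_functional[OF conjunct1[OF IH] D(1) this add smul uW u(2)]
  have "{x \<in> ?W. f a x = 0} = {x \<in> V. \<forall>j\<in>insert a J. f j x = 0}" by auto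
  thus ?case using step IH insert.hyps by simp
qed

section \<open>Substitution is a ring homomorphism\<close>

text \<open>
  One-jets are coefficients of Taylor expansions, and Taylor expansion is a substitution. Once
  substitution is known to be multiplicative, the product rule for jets follows from the
  formulas for the lowest coefficients of a product.
\<close>

lemma poly3_eq_sum_terms:
  "F = (\<Sum>m\<in>Poly_Mapping.keys F. Poly_Mapping.single m (Poly_Mapping.lookup F m))"
  by (rule poly_mapping_eqI) (auto simp: lookup_sum lookup_single when_def in_keys_iff)

lemma subst3_add: "subst3 s (F + G) = subst3 s F + subst3 s G"
  by (rule poly_mapping_eqI) (simp add: lookup_subst3_add lookup_add)

lemma subst3_sum: "subst3 s (sum f A) = (\<Sum>x\<in>A. subst3 s (f x))"
  by (induction A rule: infinite_finite_induct) (simp_all add: subst3_add, simp_all add: subst3_def)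

lemma subst3_single:
  "subst3 s (Poly_Mapping.single m c) = Const3 c * (\<Prod>j\<in>UNIV. s j ^ Poly_Mapping.lookup m j)"
  by (subst subst3_superset[of "{m}"]) auto

lemma subst3_mult: "subst3 s (F * G) = subst3 s F * subst3 s G"
proof -
  let ?t = "\<lambda>F m. Poly_Mapping.single m (Poly_Mapping.lookup F m)"
  have mult_terms: "subst3 s (?t F m * ?t G n) = subst3 s (?t F m) * subst3 s (?t G n)" for m n
  proof -
    have "Const3 (a * b) = Const3 a * (Const3 b :: 'a poly3)" for a b :: 'a
      by (simp add: Const3_def mult_single)
    thus ?thesis
      by (simp add: mult_single subst3_single lookup_add power_add prod.distrib mult_ac)
  qed
  have "subst3 s (F * G) = subst3 s ((\<Sum>m\<in>Poly_Mapping.keys F. ?t F m) * (\<Sum>n\<in>Poly_Mapping.keys G. ?t G n))"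
    by (simp flip: poly3_eq_sum_terms)
  also have "\<dots> = (\<Sum>m\<in>Poly_Mapping.keys F. subst3 s (?t F m)) * (\<Sum>n\<in>Poly_Mapping.keys G. subst3 s (?t G n))"
    by (simp add: sum_product subst3_sum mult_terms)
  also have "\<dots> = subst3 s F * subst3 s G"
    by (simp flip: subst3_sum poly3_eq_sum_terms)
  finally show ?thesis .
qed

lemma subst3_Var3: "subst3 s (Var3 i) = s i"
proof -
  have "(\<Prod>j\<in>UNIV. s j ^ Poly_Mapping.lookup (Poly_Mapping.single i 1) j) = (\<Prod>j\<in>UNIV. if i = j then s j else 1)"
    by (intro prod.cong) (auto simp: lookup_single when_def)
  thus ?thesis
    by (simp add: Var3_def subst3_single Const3_def)
qed

section \<open>One-jets\<close>

text \<open>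
  The one-jet at a point, in the chart where the coordinate \<open>i\<close> equals 1. This chart has no
  derivative in direction \<open>i\<close>, so the index \<open>k = i\<close> is used for the value at the point. Thus \<open>k\<close>
  ranges over all three coordinates and enumerates exactly the three conditions for a double
  point.
\<close>

definition jet :: "3 \<Rightarrow> 'a::field ^ 3 \<Rightarrow> 3 \<Rightarrow> 'a poly3 \<Rightarrow> 'a" where
  "jet i v k F = Poly_Mapping.lookup (taylor_chart i v F)
     (if k = i then 0 else Poly_Mapping.single k 1)"

lemma jet_add: "jet i v k (F + G) = jet i v k F + jet i v k G"
  by (simp add: jet_def taylor_chart_def lookup_subst3_add)

lemma jet_scale: "jet i v k (scale3 c F) = c * jet i v k F"
  by (simp add: jet_def taylor_chart_def lookup_subst3_scale)

lemma jet_mult: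
  "jet i v k (F * G) = (if k = i then jet i v i F * jet i v i G
     else jet i v i F * jet i v k G + jet i v k F * jet i v i G)"
  by (simp add: jet_def taylor_chart_def subst3_mult lookup_mult_0 lookup_mult_1 del: One_nat_def)

lemma double_in_chart_iff_jet:
  assumes "v $ i \<noteq> 0"
  shows "double_in_chart i v F \<longleftrightarrow> (\<forall>k. jet i v k F = 0)"
proof -
  have "double_in_chart i v F \<longleftrightarrow> Poly_Mapping.lookup (taylor_chart i v F) 0 = 0 \<and>
      (\<forall>k. Poly_Mapping.lookup (taylor_chart i v F) (Poly_Mapping.single k 1) = 0)"
    unfolding double_in_chart_def mdeg_le_1_iff by blast
  also have "\<dots> \<longleftrightarrow> (\<forall>k. jet i v k F = 0)"
    using lookup_taylor_chart_1[OF assms, of F i] unfolding jet_def by auto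
  finally show ?thesis .
qed

lemma jet_square_mult:
  assumes "jet i v i L = 0"
  shows "jet i v k (L * L * F) = 0"
  using assms by (simp add: jet_mult)

definition linear_form :: "'a::field ^ 3 \<Rightarrow> 'a poly3" where
  "linear_form c = (\<Sum>j\<in>UNIV. scale3 (c $ j) (Var3 j))"

lemma jet_Var3:
  assumes "v $ i \<noteq> 0"
  shows "jet i v k (Var3 j) = (if k = i then v $ j / v $ i else if j = k then 1 else 0)"
proof -
  have *: "Poly_Mapping.single j (1::nat) = Poly_Mapping.single k 1 \<longleftrightarrow> j = k" for k
    by (auto simp: poly_mapping_eq_iff fun_eq_iff lookup_single when_def split: if_splits)
  show ?thesis
    unfolding jet_def taylor_chart_def subst3_Var3
    using assms single_1_ne_0[of k] single_1_ne_0[of j] *[of k]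
    by (auto simp: lookup_add Const3_def Var3_def lookup_single lookup_one when_def
          simp del: One_nat_def)
qed

lemma jet_sum: "jet i v k (sum f A) = (\<Sum>x\<in>A. jet i v k (f x))"
  by (simp add: jet_def taylor_chart_def subst3_sum lookup_sum)

lemma jet_linear_form:
  assumes "v $ i \<noteq> 0"
  shows "jet i v k (linear_form c) =
    (if k = i then (\<Sum>j\<in>UNIV. c $ j * v $ j) / v $ i else c $ k)"
proof (cases "k = i")
  case True
  thus ?thesis
    using assms by (simp add: linear_form_def jet_sum jet_scale jet_Var3 sum_divide_distrib)
next
  case False
  hence "jet i v k (linear_form c) = (\<Sum>j\<in>UNIV. c $ j * (if j = k then 1 else 0))"
    using assms by (simp add: linear_form_def jet_sum jet_scale jet_Var3)
  also have "\<dots> = (\<Sum>j\<in>UNIV. if j = k then c $ j else 0)"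
    by (intro sum.cong) auto
  finally show ?thesis using False by simp
qed

text \<open>
  The derivatives prescribe all coefficients of the linear form except the one of the
  coordinate \<open>i\<close>; since that coordinate is nonzero at the point, the value prescribes the last
  one.
\<close>

lemma jet_linear_form_surj:
  assumes v: "v $ i \<noteq> 0"
  obtains c where "\<And>k. jet i v k (linear_form c) = t k"
proof
  let ?c = "\<chi> j. if j = i then t i - (\<Sum>l\<in>UNIV-{i}. t l * v $ l) / v $ i else t j"
  have "(\<Sum>j\<in>UNIV. ?c $ j * v $ j) = ?c $ i * v $ i + (\<Sum>j\<in>UNIV-{i}. ?c $ j * v $ j)"
    by (rule sum.remove) auto
  also have "(\<Sum>j\<in>UNIV-{i}. ?c $ j * v $ j) = (\<Sum>j\<in>UNIV-{i}. t j * v $ j)"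
    by (intro sum.cong) auto
  finally have "(\<Sum>j\<in>UNIV. ?c $ j * v $ j) = t i * v $ i"
    using v by (simp add: field_simps)
  thus "jet i v k (linear_form ?c) = t k" for k
    using v by (simp add: jet_linear_form)
qed

text \<open>
  In the basis given by the value and the derivatives, multiplication by \<open>H\<close> acts on one-jets
  as a triangular matrix with the value of \<open>H\<close> on its diagonal. If that value is nonzero, the
  required jet of the linear factor can therefore be solved for.
\<close>

lemma jet_mult_linear_form_surj:
  assumes v: "v $ i \<noteq> 0" and H: "jet i v i H \<noteq> 0"
  obtains c where "\<And>k. jet i v k (H * linear_form c) = t k"
proof -
  obtain c where c: "\<And>k. jet i v k (linear_form c) =
      (if k = i then t i / jet i v i H
       else (t k - jet i v k H * (t i / jet i v i H)) / jet i v i H)"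
    using jet_linear_form_surj[OF v, where t = "\<lambda>k. if k = i then t i / jet i v i H
       else (t k - jet i v k H * (t i / jet i v i H)) / jet i v i H"] by metis
  have "jet i v k (H * linear_form c) = t k" for k
    using H unfolding jet_mult c by (simp add: field_simps)
  thus ?thesis by (rule that)
qed

section \<open>The space of forms\<close>

lemma homogeneous3_mult:
  assumes "homogeneous3 d F" "homogeneous3 e G"
  shows "homogeneous3 (d + e) (F * G)"
  unfolding homogeneous3_def
proof
  fix m assume "m \<in> Poly_Mapping.keys (F * G)"
  then obtain a b where "m = a + b" "a \<in> Poly_Mapping.keys F" "b \<in> Poly_Mapping.keys G"
    using keys_mult[of F G] by blast
  thus "mdeg m = d + e"
    using assms by (simp add: homogeneous3_def mdeg_def lookup_add sum.distrib)
qed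

lemma subspace_homogeneous3: "poly3.subspace {F. homogeneous3 d F}"
  using subspace_double_forms[of d "{}"] by (simp add: double_forms_def)

lemma homogeneous3_Var3: "homogeneous3 1 (Var3 i)"
  by (simp add: homogeneous3_def Var3_def mdeg_def lookup_single when_def)

lemma homogeneous3_linear_form: "homogeneous3 1 (linear_form c)"
  using poly3.subspace_sum[OF subspace_homogeneous3[of 1], of UNIV "\<lambda>j. scale3 (c $ j) (Var3 j)"]
    poly3.subspace_scale[OF subspace_homogeneous3[of 1]] homogeneous3_Var3
  by (auto simp: linear_form_def)

text \<open>
  The third exponent of a monomial of degree \<open>d\<close> is determined by the first two.
\<close>

lemma bij_betw_monom3:
  "bij_betw (\<lambda>m. (Poly_Mapping.lookup m 1, Poly_Mapping.lookup m 2)) {m :: monom3. mdeg m = d}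
     (SIGMA i:{..d}. {..d - i})"
proof (rule bij_betwI')
  fix x y :: monom3 assume "x \<in> {m. mdeg m = d}" "y \<in> {m. mdeg m = d}"
  thus "((Poly_Mapping.lookup x 1, Poly_Mapping.lookup x 2) =
      (Poly_Mapping.lookup y 1, Poly_Mapping.lookup y 2)) = (x = y)"
    by (auto simp: mdeg_def sum_3 poly_mapping_eq_iff fun_eq_iff forall_3)
next
  fix x :: monom3 assume "x \<in> {m. mdeg m = d}"
  thus "(Poly_Mapping.lookup x 1, Poly_Mapping.lookup x 2) \<in> (SIGMA i:{..d}. {..d - i})"
    by (auto simp: mdeg_def sum_3)
next
  fix y assume y: "y \<in> (SIGMA i:{..d}. {..d - i})"
  define x :: monom3 where "x = Poly_Mapping.single 1 (fst y) + Poly_Mapping.single 2 (snd y) +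
    Poly_Mapping.single 3 (d - fst y - snd y)"
  have "x \<in> {m. mdeg m = d}" "y = (Poly_Mapping.lookup x 1, Poly_Mapping.lookup x 2)"
    using y by (auto simp: x_def mdeg_def sum_3 lookup_add lookup_single when_def)
  thus "\<exists>x\<in>{m. mdeg m = d}. y = (Poly_Mapping.lookup x 1, Poly_Mapping.lookup x 2)" by blast
qed

lemma card_monom3: "card {m. mdeg m = d} = (\<Sum>i\<le>d. Suc (d - i))"
  using bij_betw_same_card[OF bij_betw_monom3[of d]] by simp

lemma finite_monom3: "finite {m. mdeg m = d}"
  using bij_betw_finite[OF bij_betw_monom3[of d]] by simp

lemma forms_basis:
  fixes d :: nat
  defines "B \<equiv> (\<lambda>m. Poly_Mapping.single m (1::'a::field)) ` {m. mdeg m = d}"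
  shows "finite B" "{F. homogeneous3 d F} \<subseteq> poly3.span B"
    "poly3.dim {F :: 'a poly3. homogeneous3 d F} = card {m. mdeg m = d}"
proof -
  let ?M = "{m. mdeg m = d}" and ?s = "\<lambda>m :: monom3. Poly_Mapping.single m (1::'a)"
  show fin: "finite B" unfolding B_def using finite_monom3 by blast
  have inj: "inj ?s"
    by (rule injI) (metis lookup_single_eq lookup_single_not_eq zero_neq_one)
  have scale: "Poly_Mapping.single m c = scale3 c (?s m)" for m c
    by (rule poly_mapping_eqI) (simp add: lookup_single when_def)
  show span: "{F. homogeneous3 d F} \<subseteq> poly3.span B"
  proof
    fix F :: "'a poly3" assume "F \<in> {F. homogeneous3 d F}"
    hence "?s m \<in> B" if "m \<in> Poly_Mapping.keys F" for m
      using that by (auto simp: B_def homogeneous3_def)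
    hence "(\<Sum>m\<in>Poly_Mapping.keys F. scale3 (Poly_Mapping.lookup F m) (?s m)) \<in> poly3.span B"
      by (intro poly3.span_sum poly3.span_scale poly3.span_base)
    thus "F \<in> poly3.span B"
      by (simp flip: scale poly3_eq_sum_terms)
  qed
  have ind: "poly3.independent B"
  proof (rule poly3.independent_if_scalars_zero[OF fin])
    fix f b assume sum: "(\<Sum>x\<in>B. scale3 (f x) x) = 0" and b: "b \<in> B"
    obtain m where m: "b = ?s m" using b by (auto simp: B_def)
    have "Poly_Mapping.lookup (scale3 (f x) x) m = (if x = b then f b else 0)" if "x \<in> B" for x
      using that by (auto simp: B_def m lookup_single when_def split: if_splits)
    hence "Poly_Mapping.lookup (\<Sum>x\<in>B. scale3 (f x) x) m = (\<Sum>x\<in>B. if x = b then f b else 0)"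
      unfolding lookup_sum by (intro sum.cong) auto
    thus "f b = 0" using sum b fin by simp
  qed
  have sub: "B \<subseteq> {F. homogeneous3 d F}"
    by (auto simp: B_def homogeneous3_def)
  have "poly3.dim {F :: 'a poly3. homogeneous3 d F} = card B"
    using poly3.basis_card_eq_dim[OF sub span ind] by simp
  also have "card B = card {m. mdeg m = d}"
    unfolding B_def using inj by (intro card_image) (auto simp: inj_on_def)
  finally show "poly3.dim {F :: 'a poly3. homogeneous3 d F} = card {m. mdeg m = d}" .
qed

section \<open>Lines\<close>

text \<open>
  The line through two points, as a vector of coefficients.
\<close>

definition cross :: "'a::field ^ 3 \<Rightarrow> 'a ^ 3 \<Rightarrow> 'a ^ 3" where
  "cross a b = vector [a $ 2 * b $ 3 - a $ 3 * b $ 2, a $ 3 * b $ 1 - a $ 1 * b $ 3,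
     a $ 1 * b $ 2 - a $ 2 * b $ 1]"

definition det3 :: "'a::field ^ 3 \<Rightarrow> 'a ^ 3 \<Rightarrow> 'a ^ 3 \<Rightarrow> 'a" where
  "det3 a b c = (\<Sum>i\<in>UNIV. cross a b $ i * c $ i)"

lemma det3_rotate: "det3 a b c = det3 b c a" and det3_swap: "det3 a b c = - det3 b a c"
  and det3_repeated: "det3 a b a = 0" "det3 a b b = 0"
  by (simp_all add: det3_def cross_def sum_3 algebra_simps)

text \<open>
  Distinct points span a line: if all two-by-two minors of a pair of vectors vanish, the vectors
  are proportional.
\<close>

lemma cross_eq_0_imp_proj_rel:
  assumes "a \<noteq> 0" "b \<noteq> 0" "cross a b = 0"
  shows "proj_rel a b"
proof -
  obtain i where i: "a $ i \<noteq> 0" using assms by (auto simp: vec_eq_iff)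
  have c: "a $ 2 * b $ 3 = a $ 3 * b $ 2" "a $ 3 * b $ 1 = a $ 1 * b $ 3" "a $ 1 * b $ 2 = a $ 2 * b $ 1"
    using assms(3) by (auto simp: cross_def vec_eq_iff forall_3)
  have "\<forall>i j. a $ i * b $ j = a $ j * b $ i"
    unfolding forall_3 using c by auto
  hence "b $ j = b $ i / a $ i * a $ j" for j
    using i by (simp add: field_simps)
  hence eq: "b = (b $ i / a $ i) *s a"
    unfolding vec_eq_iff vector_smult_component by blast
  hence "b $ i / a $ i \<noteq> 0" using assms(2) by (metis vector_smult_lzero)
  thus ?thesis using assms eq unfolding proj_rel_def by blast
qed

definition coords :: "'a::field proj_plane \<Rightarrow> 'a ^ 3" where
  "coords p = (SOME v. v \<noteq> 0 \<and> abs_proj_plane v = p)"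

lemma coords: "coords p \<noteq> 0" "abs_proj_plane (coords p) = p"
proof -
  have "\<exists>v. v \<noteq> 0 \<and> abs_proj_plane v = p"
    using Quotient_abs_rep[OF Quotient_proj_plane] Quotient_rep_reflp[OF Quotient_proj_plane]
    unfolding proj_rel_def by metis
  from someI_ex[OF this] show "coords p \<noteq> 0" "abs_proj_plane (coords p) = p"
    by (auto simp: coords_def)
qed

lemma proj_rel_refl: "v \<noteq> 0 \<Longrightarrow> proj_rel v v"
  unfolding proj_rel_def by (auto intro!: exI[of _ 1])

lemma on_line_coords: "on_line l p \<longleftrightarrow> (\<Sum>i\<in>UNIV. l $ i * coords p $ i) = 0"
  using on_line.abs_eq[OF proj_rel_refl[OF coords(1)]] coords(2)[of p] by metis

lemma double_at_coords:
  "double_at F p \<longleftrightarrow> (\<forall>i. coords p $ i \<noteq> 0 \<longrightarrow> double_in_chart i (coords p) F)"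
  using double_at.abs_eq[OF proj_rel_refl[OF coords(1)]] coords(2)[of p] by metis

lemma cross_coords_ne_0: "p \<noteq> q \<Longrightarrow> cross (coords p) (coords q) \<noteq> 0"
  using cross_eq_0_imp_proj_rel[OF coords(1) coords(1), of p q]
    Quotient_rel_abs[OF Quotient_proj_plane] coords(2) by metis

definition chart :: "'a::field proj_plane \<Rightarrow> 3" where
  "chart p = (SOME i. coords p $ i \<noteq> 0)"

lemma chart: "coords p $ chart p \<noteq> 0"
proof -
  have "\<exists>i. coords p $ i \<noteq> 0"
    using coords(1)[of p] by (auto simp: vec_eq_iff)
  thus ?thesis unfolding chart_def by (rule someI_ex)
qed

text \<open>
  Being singular at a point does not depend on the chart, so testing it in one chosen chart
  gives just three conditions for each point.
\<close>

lemma double_at_iff_jet: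
  assumes "homogeneous3 d F"
  shows "double_at F p \<longleftrightarrow> (\<forall>k. jet (chart p) (coords p) k F = 0)"
  unfolding double_at_coords double_in_chart_iff_jet[OF chart, symmetric]
  using double_in_chart_indep[OF assms] chart by blast

section \<open>Five points\<close>

text \<open>
  A pair of the remaining points is bad if its line passes through \<open>p\<close>. Bad pairs are disjoint, as otherwise four of
  the points would be collinear. So if one of the two pairs of a splitting is bad, any splitting
  that separates this pair consists of good pairs.
\<close>

lemma splitting_lines:
  fixes S :: "'a::field proj_plane set"
  assumes S: "card S = 5" "p \<in> S"
    and gen: "\<And>T. T \<subseteq> S \<Longrightarrow> card T = 4 \<Longrightarrow> \<not> contained_in_line T"
  obtains l m where "\<not> on_line l p" "\<not> on_line m p" "\<And>q. q \<in> S - {p} \<Longrightarrow> on_line l q \<or> on_line m q"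
proof -
  have "card (S - {p}) = 4" using S by (simp add: card_Diff_singleton card_ge_0_finite)
  then obtain a b c d where abcd: "S - {p} = {a, b, c, d}" "distinct [a, b, c, d]"
    by (auto simp: numeral_eq_Suc card_Suc_eq)
  \<comment> \<open>\<open>D x y\<close>: the pair \<open>x\<close>, \<open>y\<close> is bad, i.e. collinear with \<open>p\<close>\<close>
  define D where "D x y = (det3 (coords p) (coords x) (coords y) = 0)" for x y
  have sym: "D x y = D y x" for x y
    unfolding D_def by (metis det3_rotate det3_swap neg_equal_0_iff_equal)
  have excl: "\<not> (D x y \<and> D x z)"
    if "x \<in> S - {p}" "y \<in> S - {p}" "z \<in> S - {p}" "distinct [x, y, z]" for x y z
  proof
    assume "D x y \<and> D x z"
    \<comment> \<open>the line through \<open>p\<close> and \<open>x\<close> contains the other two points\<close>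
    hence "contained_in_line {p, x, y, z}"
      unfolding contained_in_line_def
      using cross_coords_ne_0[of p x] that det3_repeated[of "coords p" "coords x"]
      by (intro exI[of _ "cross (coords p) (coords x)"])
         (auto simp: on_line_coords D_def simp flip: det3_def)
    moreover have "{p, x, y, z} \<subseteq> S" "card {p, x, y, z} = 4" using that S by auto
    ultimately show False using gen by blast
  qed
  note result = that
  have lines: thesis if D: "\<not> D x y" "\<not> D z w" and eq: "S - {p} = {x, y, z, w}" for x y z w
  proof (rule result)
    have line: "on_line (cross (coords x) (coords y)) q \<longleftrightarrow> det3 (coords x) (coords y) (coords q) = 0" for x y q
      by (simp add: on_line_coords det3_def)
    show "\<not> on_line (cross (coords x) (coords y)) p" "\<not> on_line (cross (coords z) (coords w)) p"
      using D unfolding line D_def by (metis det3_rotate)+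
    show "on_line (cross (coords x) (coords y)) q \<or> on_line (cross (coords z) (coords w)) q"
      if "q \<in> S - {p}" for q
    proof -
      have "q \<in> {x, y, z, w}" using that eq by blast
      thus ?thesis unfolding line by (elim insertE emptyE) (simp_all add: det3_repeated)
    qed
  qed
  show thesis
  proof (cases "D a b \<or> D c d")
    case False
    thus ?thesis using lines[of a b c d] abcd by blast
  next
    case True
    hence "\<not> D a c \<and> \<not> D b d"
      using excl[of a b c] excl[of b a d] excl[of c d a] excl[of d c b] abcd sym by auto
    thus ?thesis using lines[of a c b d] abcd by blast
  qed
qed

text \<open>
  With \<open>L\<close> and \<open>M\<close> the two lines of the splitting, a multiple of \<open>L\<^sup>2 M\<^sup>2\<close> is singular at every
  point of either line, hence at the four remaining points. The coordinate that is 1 in the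
  chart at \<open>p\<close> brings the degree from four to five without vanishing at \<open>p\<close>; the last linear
  factor is free to adjust the jet.
\<close>

lemma sextic_with_jet:
  fixes S :: "'a::field proj_plane set"
  assumes S: "card S = 5" "p \<in> S"
    and gen: "\<And>T. T \<subseteq> S \<Longrightarrow> card T = 4 \<Longrightarrow> \<not> contained_in_line T"
  obtains F where "homogeneous3 6 F" "\<And>k. jet (chart p) (coords p) k F = t k"
    "\<And>q k. q \<in> S - {p} \<Longrightarrow> jet (chart q) (coords q) k F = 0"
proof -
  let ?j = "\<lambda>q. jet (chart q) (coords q)"
  obtain l m where lm: "\<not> on_line l p" "\<not> on_line m p"
    and cover: "\<And>q. q \<in> S - {p} \<Longrightarrow> on_line l q \<or> on_line m q"
    using splitting_lines[OF S gen] by metis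
  define L M where "L = linear_form l" and "M = linear_form m"
  have j0: "?j q (chart q) (linear_form c) = 0 \<longleftrightarrow> on_line c q"
    for q and c :: "'a ^ 3"
    using chart[of q] by (simp add: jet_linear_form on_line_coords)
  define H where "H = L * L * (M * M * Var3 (chart p))"
  have "?j p (chart p) H \<noteq> 0"
    using lm chart[of p] by (simp add: H_def jet_mult jet_Var3 L_def M_def j0)
  then obtain c where c: "\<And>k. ?j p k (H * linear_form c) = t k"
    using jet_mult_linear_form_surj[OF chart] by metis
  have hom1: "homogeneous3 (Suc 0) (linear_form c)" "homogeneous3 (Suc 0) (Var3 i :: 'a poly3)" for c :: "'a ^ 3" and i
    using homogeneous3_linear_form homogeneous3_Var3 by auto
  have "homogeneous3 (Suc 0 + Suc 0 + (Suc 0 + Suc 0 + Suc 0) + Suc 0) (H * linear_form c)"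
    unfolding H_def L_def M_def by (intro homogeneous3_mult hom1)
  hence "homogeneous3 6 (H * linear_form c)" by (simp add: numeral_eq_Suc)
  moreover have "?j q k (H * linear_form c) = 0" if "q \<in> S - {p}" for q k
  proof -
    have "H * linear_form c = L * L * (M * M * Var3 (chart p) * linear_form c)"
      "H * linear_form c = M * M * (L * L * Var3 (chart p) * linear_form c)"
      by (simp_all add: H_def mult_ac)
    thus ?thesis using cover[OF that] jet_square_mult j0 unfolding L_def M_def by metis
  qed
  ultimately show ?thesis using c that by blast
qed

lemma dim_double_sextics:
  fixes S :: "'a::field proj_plane set"
  assumes S: "card S = 5"
    and gen: "\<And>T. T \<subseteq> S \<Longrightarrow> card T = 4 \<Longrightarrow> \<not> contained_in_line T"
  shows "poly3.dim (double_forms 6 S) = 13"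
proof -
  define f :: "'a proj_plane \<times> 3 \<Rightarrow> 'a poly3 \<Rightarrow> 'a"
    where "f = (\<lambda>(p, k). jet (chart p) (coords p) k)"
  let ?V = "{F :: 'a poly3. homogeneous3 6 F}" and ?J = "S \<times> (UNIV :: 3 set)"
  have finS: "finite S" using S by (simp add: card_ge_0_finite)
  have add: "f j (x + y) = f j x + f j y" and scale: "f j (scale3 c x) = c * f j x" for j c x y
    by (cases j; simp add: f_def jet_add jet_scale)+
  have dual: "\<exists>u\<in>?V. f j u \<noteq> 0 \<and> (\<forall>i\<in>?J. i \<noteq> j \<longrightarrow> f i u = 0)" if j: "j \<in> ?J" for j
  proof -
    obtain p k where pk: "j = (p, k)" "p \<in> S" using j by auto
    obtain F where F: "homogeneous3 6 F"
      "\<And>l. jet (chart p) (coords p) l F = (if l = k then 1 else 0)"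
      "\<And>q l. q \<in> S - {p} \<Longrightarrow> jet (chart q) (coords q) l F = 0"
      using sextic_with_jet[OF S pk(2) gen, where t = "\<lambda>l. if l = k then 1 else 0"] by metis
    have "f (q, l) F = 0" if "q \<in> S" "(q, l) \<noteq> j" for q l
      using that F(2,3) pk(1) unfolding f_def by (cases "q = p") auto
    moreover have "f j F \<noteq> 0" using F(2) by (simp add: f_def pk)
    ultimately show ?thesis using F(1) by (intro bexI[of _ F]) auto
  qed
  have "poly3.dim ?V = poly3.dim {F \<in> ?V. \<forall>j\<in>?J. f j F = 0} + card ?J"
    using poly3.dim_common_kernel[OF subspace_homogeneous3 forms_basis(1,2) add scale _ dual] finS
    by simp
  moreover have "{F \<in> ?V. \<forall>j\<in>?J. f j F = 0} = double_forms 6 S"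
    using double_at_iff_jet[of 6] by (auto simp: double_forms_def f_def)
  moreover have "card ?J = 15" using S by (simp add: card_cartesian_product)
  moreover have "poly3.dim ?V = 28"
    unfolding forms_basis(3) card_monom3 by (simp add: eval_nat_numeral)
  ultimately show ?thesis by simp
qed

theorem proposition2p2p6:
  fixes S :: "'k::field alg_closure proj_plane set"
  assumes "card S = 5"
    and "\<And>T. T \<subseteq> S \<Longrightarrow> card T = 4 \<Longrightarrow> \<not> contained_in_line T"
  shows "proj_dim (double_forms 6 S) = 12"
  using dim_double_sextics[OF assms] by (simp add: proj_dim_def)

end
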